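(* For every integer $n\geq 1$, $$N_{n}(t)=\left(\frac{1+yt}{1+y}\right)^{n+1}P^{(\mathrm{pk},\mathrm{des})}\left(\mathrm{Av}_{n}(231);\frac{(1+y)^{2}t}{(y+t)(1+yt)},\frac{y+t}{1+yt}\right).$$ Equivalently, $$P^{(\mathrm{pk},\mathrm{des})}(\mathrm{Av}_{n}(231);y,t)=\left(\frac{1+u}{1+uv}\right)^{n+1}N_{n}(v),$$ where $$u=\frac{1+t^{2}-2yt-(1-t)\sqrt{(1+t)^{2}-4yt}}{2(1-y)t},\qquad v=\frac{(1+t)^{2}-2yt-(1+t)\sqrt{(1+t)^{2}-4yt}}{2yt}.$$
   Context: $\mathfrak{S}_n$ is the set of permutations $\pi=\pi_1\cdots\pi_n$ of $[n]=\{1,\dots,n\}$. For $\pi\in\mathfrak{S}_n$, $\mathrm{des}(\pi)$ is the number of $i\in[n-1]$ with $\pi_i>\pi_{i+1}$, and $\mathrm{pk}(\pi)$ is the number of $i$ with $2\le i\le n-1$ and $\pi_{i-1}<\pi_i>\pi_{i+1}$. $\mathrm{Av}_n(231)$ is the set of $231$-avoiding permutations in $\mathfrak{S}_n$, i.e. those for which there are no $i<j<k$ with $\pi_k<\pi_i<\pi_j$. For $\Pi\subseteq\mathfrak{S}_n$, $P^{(\mathrm{pk},\mathrm{des})}(\Pi;y,t)=\sum_{\pi\in\Pi}y^{\mathrm{pk}(\pi)+1}t^{\mathrm{des}(\pi)+1}$. The $n$th Narayana polynomial is $N_n(t)=\sum_{\pi\in\mathrm{Av}_n(231)}t^{\mathrm{des}(\pi)+1}=\frac1n\sum_{k=1}^n\binom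 nk\binom n{k-1}t^k$ for $n\ge1$ (the equality of these two expressions is a known fact). Here $y,t$ are indeterminates; the first identity is an identity of rational functions in $y,t$. In the second identity, $\sqrt{(1+t)^2-4yt}$ is the formal power series in $t$ over $\mathbb{Q}[y]$ with constant term $1$, so that $u$ and $v$ are formal power series in $t$ with coefficients in $\mathbb{Q}[y]$. *)

theory Defs
  imports
    "HOL-Combinatorics.Multiset_Permutations"
    "HOL-Computational_Algebra.Formal_Power_Series"
    "HOL-Computational_Algebra.Polynomial_Factorial"
begin

text \<open>A permutation \<open>\<pi>\<^sub>1 \<cdots> \<pi>\<^sub>n\<close> of \<open>[n]\<close> is the list of its values, an element of
  \<open>permutations_of_set {1..n}\<close>. List positions start at 0, so \<open>\<pi>\<^sub>i\<close> is \<open>xs ! (i - 1)\<close>.\<close>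

definition des :: "nat list \<Rightarrow> nat" where
  "des xs = card {i. i + 1 < length xs \<and> xs ! i > xs ! (i + 1)}"

definition pk :: "nat list \<Rightarrow> nat" where
  "pk xs = card {i. 0 < i \<and> i + 1 < length xs \<and> xs ! (i - 1) < xs ! i \<and> xs ! i > xs ! (i + 1)}"

definition avoids_231 :: "nat list \<Rightarrow> bool" where
  "avoids_231 xs \<longleftrightarrow>
     \<not> (\<exists>i j k. i < j \<and> j < k \<and> k < length xs \<and> xs ! k < xs ! i \<and> xs ! i < xs ! j)"

definition Av231 :: "nat \<Rightarrow> nat list set" where
  "Av231 n = {xs \<in> permutations_of_set {1..n}. avoids_231 xs}"

text \<open>The polynomials are given by their values at elements of an arbitrary commutative ring;
  taking indeterminates as arguments gives the polynomials themselves.\<close>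

definition P_pk_des :: "nat list set \<Rightarrow> 'a::comm_ring_1 \<Rightarrow> 'a \<Rightarrow> 'a" where
  "P_pk_des S y t = (\<Sum>\<pi>\<in>S. y ^ (pk \<pi> + 1) * t ^ (des \<pi> + 1))"

definition narayana :: "nat \<Rightarrow> 'a::comm_ring_1 \<Rightarrow> 'a" where
  "narayana n t = (\<Sum>\<pi>\<in>Av231 n. t ^ (des \<pi> + 1))"

text \<open>The field of rational functions in \<open>y\<close> and \<open>t\<close> is the fraction field of \<open>\<rat>[y][t]\<close>.\<close>

type_synonym ratfun = "rat poly poly fract"

definition y_rf :: ratfun where "y_rf = to_fract [:[:0, 1:]:]"

definition t_rf :: ratfun where "t_rf = to_fract [:0, 1:]"

text \<open>The ring \<open>\<rat>[y][[t]]\<close>.\<close>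

type_synonym yseries = "rat poly fps"

definition y_ps :: yseries where "y_ps = fps_const [:0, 1:]"

definition t_ps :: yseries where "t_ps = fps_X"

text \<open>The quotient \<open>a / b\<close> in an integral domain; it is meaningful when \<open>b \<noteq> 0\<close> and \<open>b\<close> divides
  \<open>a\<close>. The library has no division on power series whose coefficients are polynomials.\<close>

definition exact_quot :: "'a::idom \<Rightarrow> 'a \<Rightarrow> 'a" where
  "exact_quot a b = (THE q. q * b = a)"

definition sqrt_ps :: yseries where
  "sqrt_ps = (THE s. s ^ 2 = (1 + t_ps) ^ 2 - 4 * y_ps * t_ps \<and> fps_nth s 0 = 1)"

definition u_ps :: yseries where
  "u_ps = exact_quot (1 + t_ps ^ 2 - 2 * y_ps * t_ps - (1 - t_ps) * sqrt_ps)
                     (2 * (1 - y_ps) * t_ps)"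

definition v_ps :: yseries where
  "v_ps = exact_quot ((1 + t_ps) ^ 2 - 2 * y_ps * t_ps - (1 + t_ps) * sqrt_ps)
                     (2 * y_ps * t_ps)"

text \<open>The descriptions above are well defined: the square root exists uniquely, and all the
  quotients that are formed are exact in \<open>\<rat>[y][[t]]\<close>.\<close>

lemma exact_quot_mult:
  assumes "b \<noteq> 0" "b dvd a"
  shows "exact_quot a b * b = a"
proof -
  obtain q where q: "a = b * q" using assms(2) by (elim dvdE)
  have "exact_quot a b = q"
    unfolding exact_quot_def by (rule the_equality) (use assms(1) q in \<open>auto simp: mult.commute\<close>)
  thus ?thesis by (simp add: q mult.commute)
qed

lemma fps_sqrt_unique:
  fixes s s' :: "'a::{idom, ring_char_0} fps"
  assumes "s ^ 2 = s' ^ 2" "fps_nth s 0 = 1" "fps_nth s' 0 = 1"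
  shows "s = s'"
proof -
  have "s = s' \<or> s = - s'" using assms(1) by (simp add: power2_eq_iff)
  moreover have "s \<noteq> - s'"
  proof
    assume "s = - s'"
    hence "fps_nth s 0 = - fps_nth s' 0" by simp
    thus False using assms(2,3) by (simp add: eq_neg_iff_add_eq_0)
  qed
  ultimately show ?thesis by blast
qed

lemma fps_sqrt_exists:
  fixes z :: yseries
  assumes z: "fps_nth z 0 = 0"
  shows "\<exists>s. s ^ 2 = 1 + z \<and> fps_nth s 0 = 1"
proof -
  define b :: "rat fps" where "b = fps_binomial (1/2)"
  define c :: yseries where "c = Abs_fps (\<lambda>n. [:fps_nth b n:])"
  have hom: "[:\<Sum>i\<in>A. f i:] = (\<Sum>i\<in>A. [:f i:])" if "finite A" for f :: "nat \<Rightarrow> rat" and A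
    using that by (induction A) (simp_all, metis add_0 add_pCons)
  have "b * b = fps_binomial 1"
    unfolding b_def by (subst fps_binomial_add_mult [symmetric]) simp
  hence bb: "b * b = 1 + fps_X" using fps_binomial_of_nat [of 1, where 'a = rat] by simp
  have "c * c = 1 + fps_X"
  proof (rule fps_ext)
    fix n
    have "fps_nth (c * c) n = [:fps_nth (b * b) n:]"
      by (simp add: fps_mult_nth c_def hom mult.commute)
    thus "fps_nth (c * c) n = fps_nth (1 + fps_X) n"
      unfolding bb by (simp add: one_pCons)
  qed
  hence "(c oo z) * (c oo z) = (1 + fps_X) oo z"
    using z by (metis fps_compose_mult_distrib)
  hence "(c oo z) ^ 2 = 1 + z"
    using z by (simp add: power2_eq_square fps_compose_add_distrib)
  moreover have "fps_nth (c oo z) 0 = 1"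
    by (simp add: c_def b_def one_pCons)
  ultimately show ?thesis by blast
qed

lemma sqrt_ps:
  shows sqrt_ps_square: "sqrt_ps ^ 2 = (1 + t_ps) ^ 2 - 4 * y_ps * t_ps"
    and sqrt_ps_nth_0: "fps_nth sqrt_ps 0 = 1"
proof -
  let ?z = "2 * t_ps + t_ps ^ 2 - 4 * y_ps * t_ps"
  have "(1 + t_ps) ^ 2 - 4 * y_ps * t_ps = 1 + ?z"
    by (simp add: power2_eq_square algebra_simps)
  moreover have "fps_nth ?z 0 = 0" by (simp add: t_ps_def)
  ultimately have "\<exists>s. s ^ 2 = (1 + t_ps) ^ 2 - 4 * y_ps * t_ps \<and> fps_nth s 0 = 1"
    using fps_sqrt_exists [of ?z] by (simp only:)
  hence "\<exists>!s. s ^ 2 = (1 + t_ps) ^ 2 - 4 * y_ps * t_ps \<and> fps_nth s 0 = 1"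
    using fps_sqrt_unique by (metis (no_types, lifting))
  from theI' [OF this]
  show "sqrt_ps ^ 2 = (1 + t_ps) ^ 2 - 4 * y_ps * t_ps" "fps_nth sqrt_ps 0 = 1"
    unfolding sqrt_ps_def by auto
qed

definition eval_y :: "rat \<Rightarrow> yseries \<Rightarrow> rat fps" where
  "eval_y a f = Abs_fps (\<lambda>n. poly (fps_nth f n) a)"

lemma eval_y_simps [simp]:
  "eval_y a (f + g) = eval_y a f + eval_y a g"
  "eval_y a (f - g) = eval_y a f - eval_y a g"
  "eval_y a (f * g) = eval_y a f * eval_y a g"
  "eval_y a 1 = 1"
  "eval_y a (numeral k) = numeral k"
  "eval_y a t_ps = fps_X"
  "eval_y a y_ps = fps_const a"
  by (auto simp: eval_y_def fps_eq_iff fps_mult_nth poly_sum t_ps_def y_ps_def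
        fps_numeral_nth fps_const_def)

lemma eval_y_power [simp]: "eval_y a (f ^ k) = eval_y a f ^ k"
  by (induction k) auto

lemma eval_y_sqrt_ps:
  assumes "r ^ 2 = (1 + fps_X) ^ 2 - 4 * fps_const a * fps_X" "fps_nth r 0 = 1"
  shows "eval_y a sqrt_ps = r"
proof (rule fps_sqrt_unique)
  have "eval_y a (sqrt_ps ^ 2) = eval_y a ((1 + t_ps) ^ 2 - 4 * y_ps * t_ps)"
    by (simp only: sqrt_ps_square)
  thus "eval_y a sqrt_ps ^ 2 = r ^ 2" using assms(1) by simp
  show "fps_nth (eval_y a sqrt_ps) 0 = 1" by (simp add: eval_y_def sqrt_ps_nth_0)
qed (use assms in auto)

lemma linear_t_dvd:
  fixes f :: yseries
  assumes "fps_nth f 0 = 0" "eval_y a f = 0"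
  shows "2 * fps_const [:-a, 1:] * t_ps dvd f"
proof -
  have "\<exists>q. fps_nth f n = [:-a, 1:] * q" for n
  proof -
    have "poly (fps_nth f n) a = 0"
      using assms(2) by (simp add: eval_y_def fps_eq_iff)
    thus ?thesis unfolding poly_eq_0_iff_dvd dvd_def .
  qed
  then obtain q where q: "\<And>n. fps_nth f n = [:-a, 1:] * q n" by metis
  define g :: yseries where "g = Abs_fps (\<lambda>n. smult (1/2) (q (Suc n)))"
  have g: "2 * g = Abs_fps (\<lambda>n. q (Suc n))"
    by (simp only: mult_2 g_def fps_eq_iff fps_add_nth fps_nth_Abs_fps flip: smult_add_left) simp
  have "f = fps_const [:-a, 1:] * (fps_X * (2 * g))"
  proof (rule fps_ext)
    fix n
    show "fps_nth f n = fps_nth (fps_const [:-a, 1:] * (fps_X * (2 * g))) n"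
      unfolding g fps_mult_left_const_nth using assms(1) q by (cases n) auto
  qed
  hence "f = 2 * fps_const [:-a, 1:] * t_ps * g"
    by (simp only: t_ps_def ac_simps)
  thus ?thesis by (rule dvdI)
qed

lemma y_ps_factor:
  "2 * y_ps * t_ps = 2 * fps_const [:-0, 1:] * t_ps"
  "2 * (1 - y_ps) * t_ps = - (2 * fps_const [:-1, 1:] * t_ps)"
proof -
  have "1 - y_ps = - fps_const [:-1, 1:]"
    by (simp add: y_ps_def fps_eq_iff one_pCons)
  thus "2 * (1 - y_ps) * t_ps = - (2 * fps_const [:-1, 1:] * t_ps)"
    by (simp only: mult_minus_left mult_minus_right)
qed (simp add: y_ps_def)

lemma linear_t_nonzero: "2 * fps_const [:-a, 1:] * t_ps \<noteq> (0 :: yseries)"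
  by (simp add: t_ps_def)

lemma u_ps_eq:
  "u_ps * (2 * (1 - y_ps) * t_ps) = 1 + t_ps ^ 2 - 2 * y_ps * t_ps - (1 - t_ps) * sqrt_ps"
  unfolding u_ps_def
proof (rule exact_quot_mult)
  show "2 * (1 - y_ps) * t_ps \<noteq> 0"
    unfolding y_ps_factor using linear_t_nonzero [of 1] by simp
  have e: "eval_y 1 sqrt_ps = 1 - fps_X"
    by (rule eval_y_sqrt_ps) (simp_all add: power2_eq_square algebra_simps)
  show "2 * (1 - y_ps) * t_ps dvd 1 + t_ps ^ 2 - 2 * y_ps * t_ps - (1 - t_ps) * sqrt_ps"
    unfolding y_ps_factor(2) minus_dvd_iff
  proof (rule linear_t_dvd)
    show "fps_nth (1 + t_ps ^ 2 - 2 * y_ps * t_ps - (1 - t_ps) * sqrt_ps) 0 = 0"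
      by (simp add: t_ps_def sqrt_ps_nth_0 power2_eq_square)
    show "eval_y 1 (1 + t_ps ^ 2 - 2 * y_ps * t_ps - (1 - t_ps) * sqrt_ps) = 0"
      by (simp add: e power2_eq_square algebra_simps)
  qed
qed

lemma v_ps_eq:
  "v_ps * (2 * y_ps * t_ps) = (1 + t_ps) ^ 2 - 2 * y_ps * t_ps - (1 + t_ps) * sqrt_ps"
  unfolding v_ps_def
proof (rule exact_quot_mult)
  show "2 * y_ps * t_ps \<noteq> 0"
    unfolding y_ps_factor using linear_t_nonzero [of 0] by simp
  have e: "eval_y 0 sqrt_ps = 1 + fps_X"
    by (rule eval_y_sqrt_ps) simp_all
  show "2 * y_ps * t_ps dvd (1 + t_ps) ^ 2 - 2 * y_ps * t_ps - (1 + t_ps) * sqrt_ps"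
    unfolding y_ps_factor(1)
  proof (rule linear_t_dvd)
    show "fps_nth ((1 + t_ps) ^ 2 - 2 * fps_const [:-0, 1:] * t_ps - (1 + t_ps) * sqrt_ps) 0 = 0"
      by (simp add: t_ps_def sqrt_ps_nth_0 power2_eq_square)
    have "eval_y 0 ((1 + t_ps) ^ 2 - 2 * y_ps * t_ps - (1 + t_ps) * sqrt_ps) = 0"
      by (simp add: e power2_eq_square)
    thus "eval_y 0 ((1 + t_ps) ^ 2 - 2 * fps_const [:-0, 1:] * t_ps - (1 + t_ps) * sqrt_ps) = 0"
      unfolding y_ps_factor(1) .
  qed
qed

lemma u_ps_nth_0: "fps_nth u_ps 0 = 0"
proof -
  have c: "fps_nth (2 * y_ps * t_ps) 1 = [:0, 2:]" "fps_nth (4 * y_ps * t_ps) 1 = [:0, 4:]"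
    by (simp_all add: t_ps_def y_ps_def numeral_fps_const numeral_poly)
  have "fps_nth (sqrt_ps ^ 2) 1 = fps_nth ((1 + t_ps) ^ 2 - 4 * y_ps * t_ps) 1"
    by (simp only: sqrt_ps_square)
  hence "2 * fps_nth sqrt_ps 1 = 2 - [:0, 4:]"
    unfolding fps_sub_nth c
    by (simp add: power2_eq_square fps_mult_nth_1 sqrt_ps_nth_0 t_ps_def numeral_poly)
  also have "\<dots> = 2 * (1 - [:0, 2:])" by (simp add: numeral_poly one_pCons)
  finally have s: "fps_nth sqrt_ps 1 = 1 - [:0, 2:]" by (subst (asm) mult_cancel_left) simp
  have "fps_nth (u_ps * (2 * (1 - y_ps) * t_ps)) 1 = 0"
    unfolding u_ps_eq fps_sub_nth c
    using s by (simp add: power2_eq_square fps_mult_nth_1 sqrt_ps_nth_0 t_ps_def)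
  moreover have "fps_nth (u_ps * (2 * (1 - y_ps) * t_ps)) 1 =
      - (fps_nth u_ps 0 * (2 * [:-1, 1:]))"
    unfolding y_ps_factor
    by (simp add: fps_mult_nth_1 t_ps_def)
  moreover have "2 * [:-1, 1:] \<noteq> (0 :: rat poly)" by (simp add: numeral_poly)
  ultimately show ?thesis by (metis mult_eq_0_iff neg_equal_0_iff_equal)
qed

lemma exact_quot_one_plus_uv:
  "exact_quot (1 + u_ps) (1 + u_ps * v_ps) * (1 + u_ps * v_ps) = 1 + u_ps"
proof (rule exact_quot_mult)
  have c: "fps_nth (1 + u_ps * v_ps) 0 = 1" by (simp add: u_ps_nth_0)
  show "1 + u_ps * v_ps \<noteq> 0"
  proof
    assume "1 + u_ps * v_ps = 0"
    with c show False by simp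
  qed
  have "(1 + u_ps * v_ps) * fps_right_inverse (1 + u_ps * v_ps) 1 = 1"
    by (rule fps_right_inverse) (use c in simp)
  thus "1 + u_ps * v_ps dvd 1 + u_ps" by (metis dvdI dvd_trans one_dvd)
qed

end

theory Submission
  imports Defs
begin

text \<open>A 231-avoiding permutation of \<open>[m + 1]\<close> is \<open>\<sigma> (m + 1) \<tau>\<close> with \<open>\<sigma>\<close> and \<open>\<tau>\<close> avoiding 231 and
  every entry of \<open>\<sigma>\<close> below every entry of \<open>\<tau>\<close>. Hence the polynomials \<open>a\<^sub>n = P(Av\<^sub>n; y, t)\<close> satisfy
  \<open>a\<^sub>1 = y t\<close> and \<open>a\<^sub>m\<^sub>+\<^sub>1 = (1 + t) a\<^sub>m + \<Sum> a\<^sub>k a\<^sub>m\<^sub>-\<^sub>k\<close>, the sum being over \<open>0 < k < m\<close>. The rescaling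
  \<open>a\<^sub>n \<mapsto> d\<^sup>n\<^sup>+\<^sup>1 a\<^sub>n\<close> preserves this shape of recurrence: it only multiplies \<open>1 + t\<close> by \<open>d\<close> and \<open>y t\<close> by
  \<open>d\<^sup>2\<close>. Both identities are instances of this, with \<open>N\<^sub>n(t) = P(Av\<^sub>n; 1, t)\<close>.\<close>

section \<open>Structural recursions for descents, peaks and avoidance\<close>

lemma des_short [simp]: "des [] = 0" "des [x] = 0"
  by (simp_all add: des_def)

lemma des_Cons_Cons [simp]: "des (x # y # zs) = of_bool (y < x) + des (y # zs)"
proof -
  let ?A = "\<lambda>xs. {i. i + 1 < length xs \<and> xs ! i > xs ! (i + 1)}"
  have "?A (x # y # zs) = (if y < x then {0} else {}) \<union> Suc ` ?A (y # zs)"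
  proof (rule set_eqI)
    show "i \<in> ?A (x # y # zs) \<longleftrightarrow> i \<in> (if y < x then {0} else {}) \<union> Suc ` ?A (y # zs)" for i
      by (cases i) auto
  qed
  moreover have "finite (?A (y # zs))"
    by (rule finite_subset [of _ "{..length (y # zs)}"]) auto
  ultimately show ?thesis
    by (auto simp: des_def card_image card_insert_if)
qed

lemma pk_short [simp]:
  assumes "length xs \<le> 2"
  shows "pk xs = 0"
proof -
  have "{i. 0 < i \<and> i + 1 < length xs \<and> xs ! (i - 1) < xs ! i \<and> xs ! i > xs ! (i + 1)} = {}"
    using assms by auto
  then show ?thesis by (simp only: pk_def card.empty)
qed

lemma pk_Cons_Cons_Cons [simp]:
  "pk (x # y # z # zs) = of_bool (x < y \<and> z < y) + pk (y # z # zs)"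
proof -
  let ?A = "\<lambda>xs. {i. 0 < i \<and> i + 1 < length xs \<and> xs ! (i - 1) < xs ! i \<and> xs ! i > xs ! (i + 1)}"
  \<comment> \<open>Position 0 never counts, so prepending \<open>x\<close> can create a peak only
    at position 1; every old peak moves up by one.\<close>
  have "?A (x # y # z # zs) = (if x < y \<and> z < y then {1} else {}) \<union> Suc ` ?A (y # z # zs)"
  proof (rule set_eqI)
    show "i \<in> ?A (x # y # z # zs) \<longleftrightarrow>
        i \<in> (if x < y \<and> z < y then {1} else {}) \<union> Suc ` ?A (y # z # zs)" for i
      by (cases i; cases "i - 1") auto
  qed
  moreover have "finite (?A (y # z # zs))"
    by (rule finite_subset [of _ "{..length (y # z # zs)}"]) auto
  ultimately show ?thesis
    by (auto simp: pk_def card_image card_insert_if)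
qed

lemma avoids_231_Nil [simp]: "avoids_231 []"
  by (simp add: avoids_231_def)

text \<open>The head of the list can occur in a pattern only as its first letter, the 2. The
  remaining condition concerns pairs of later entries, so \<open>sorted_wrt\<close> makes avoidance
  accessible to induction on lists.\<close>

lemma avoids_231_Cons [simp]:
  "avoids_231 (x # xs) \<longleftrightarrow> sorted_wrt (\<lambda>b c. \<not> (c < x \<and> x < b)) xs \<and> avoids_231 xs"
proof -
  have "(\<exists>i j k. i < j \<and> j < k \<and> k < length (x # xs) \<and>
          (x # xs) ! k < (x # xs) ! i \<and> (x # xs) ! i < (x # xs) ! j) \<longleftrightarrow>
        (\<exists>j k. j < k \<and> k < length xs \<and> xs ! k < x \<and> x < xs ! j) \<or>
        (\<exists>i j k. i < j \<and> j < k \<and> k < length xs \<and> xs ! k < xs ! i \<and> xs ! i < xs ! j)"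
    (is "?L \<longleftrightarrow> ?R1 \<or> ?R2")
  proof
    assume ?L
    then obtain i j k where *: "i < j" "j < k" "k < length (x # xs)"
      "(x # xs) ! k < (x # xs) ! i" "(x # xs) ! i < (x # xs) ! j" by blast
    obtain j' k' where jk: "j = Suc j'" "k = Suc k'"
      using * by (metis not_less_zero nat.exhaust)
    show "?R1 \<or> ?R2"
    proof (cases i)
      case 0
      with * jk have ?R1 by auto
      then show ?thesis ..
    next
      case (Suc i')
      with * jk have ?R2 by auto
      then show ?thesis ..
    qed
  next
    assume "?R1 \<or> ?R2"
    then show ?L
    proof
      assume ?R1
      then obtain j k where "j < k \<and> k < length xs \<and> xs ! k < x \<and> x < xs ! j" by blast
      then show ?L by (intro exI [of _ 0] exI [of _ "Suc j"] exI [of _ "Suc k"]) auto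
    next
      assume ?R2
      then obtain i j k where
        "i < j \<and> j < k \<and> k < length xs \<and> xs ! k < xs ! i \<and> xs ! i < xs ! j" by blast
      then show ?L by (intro exI [of _ "Suc i"] exI [of _ "Suc j"] exI [of _ "Suc k"]) auto
    qed
  qed
  then show ?thesis
    unfolding avoids_231_def sorted_wrt_iff_nth_less by blast
qed

section \<open>Shifting values and splitting at the maximum\<close>

lemma avoids_231_map_add [simp]: "avoids_231 (map (\<lambda>x. x + k) xs) \<longleftrightarrow> avoids_231 xs"
  by (induction xs) (simp_all add: sorted_wrt_map)

lemma des_map_add [simp]: "des (map (\<lambda>x. x + k) xs) = des xs"
  by (induction xs rule: induct_list012) simp_all

lemma pk_map_add [simp]: "pk (map (\<lambda>x. x + k) xs) = pk xs"
proof (induction xs)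
  case (Cons x xs)
  then show ?case by (cases xs; cases "tl xs") simp_all
qed simp

text \<open>The maximum can only be the 3 of a pattern, which then needs a larger entry on its left
  than on its right. A pattern that straddles the maximum without using it has its 2 on the left and
  its 1 on the right, so it too needs such a pair.\<close>

lemma avoids_231_append_max:
  assumes "\<forall>x\<in>set xs \<union> set ys. x < a"
  shows "avoids_231 (xs @ a # ys) \<longleftrightarrow>
    avoids_231 xs \<and> avoids_231 ys \<and> (\<forall>x\<in>set xs. \<forall>y\<in>set ys. x \<le> y)"
  using assms
proof (induction xs)
  case Nil
  then have "sorted_wrt (\<lambda>b c. \<not> (c < a \<and> a < b)) ys"
    by (induction ys) auto
  then show ?case by simp
next
  case (Cons x xs)
  have "sorted_wrt (\<lambda>b c. \<not> (c < x \<and> x < b)) ys" if "\<forall>y\<in>set ys. x \<le> y"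
    using that by (induction ys) auto
  with Cons show ?case
    by (auto simp: sorted_wrt_append not_less)
qed

lemma des_append_max:
  assumes "\<forall>x\<in>set xs \<union> set ys. x < a"
  shows "des (xs @ a # ys) = des xs + des ys + of_bool (ys \<noteq> [])"
  using assms
proof (induction xs)
  case Nil
  then show ?case by (cases ys) auto
next
  case (Cons x xs)
  then show ?case by (cases xs) auto
qed

text \<open>The maximum is a peak exactly when it has two neighbours. Its neighbours are ends of
  \<open>xs\<close> and \<open>ys\<close>, hence no peaks there, and standing next to a larger entry
  they do not become peaks.\<close>

lemma pk_append_max:
  assumes "\<forall>x\<in>set xs \<union> set ys. x < a"
  shows "pk (xs @ a # ys) = pk xs + pk ys + of_bool (xs \<noteq> [] \<and> ys \<noteq> [])"
  using assms
proof (induction xs)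
  case Nil
  then show ?case by (cases ys; cases "tl ys") auto
next
  case (Cons x xs)
  then show ?case
    by (cases xs; cases "tl xs"; cases ys) auto
qed

section \<open>Decomposition of 231-avoiding permutations\<close>

lemma Av231_iff:
  "xs \<in> Av231 n \<longleftrightarrow> set xs = {1..n} \<and> distinct xs \<and> avoids_231 xs"
  by (auto simp: Av231_def permutations_of_set_def)

lemma length_Av231: "xs \<in> Av231 n \<Longrightarrow> length xs = n"
  by (metis Av231_iff card_atLeastAtMost diff_Suc_1 distinct_card)

lemma finite_Av231 [simp]: "finite (Av231 n)"
  by (simp add: Av231_def)

lemma Av231_0: "Av231 0 = {[]}"
  by (auto simp: Av231_iff)

lemma Av231_append_map:
  assumes "k \<le> m" "xs \<in> Av231 k" "ys \<in> Av231 (m - k)"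
  shows "xs @ Suc m # map (\<lambda>x. x + k) ys \<in> Av231 (Suc m)"
proof -
  have s: "set xs = {1..k}" "set (map (\<lambda>x. x + k) ys) = {k + 1..m}"
    using assms image_add_atLeastAtMost' [of k 1 "m - k"] by (auto simp: Av231_iff)
  have "\<forall>x\<in>set xs \<union> set (map (\<lambda>x. x + k) ys). x < Suc m"
    unfolding s using assms(1) by auto
  then have "avoids_231 (xs @ Suc m # map (\<lambda>x. x + k) ys)"
    using assms s by (subst avoids_231_append_max) (auto simp: Av231_iff)
  moreover have "set (xs @ Suc m # map (\<lambda>x. x + k) ys) = {1..Suc m}"
    using assms(1) unfolding set_append list.set s by auto
  moreover have "distinct (xs @ Suc m # map (\<lambda>x. x + k) ys)"
    using assms s unfolding distinct_append distinct.simps list.set s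
    by (auto simp: Av231_iff distinct_map)
  ultimately show ?thesis
    by (simp only: Av231_iff)
qed

lemma Av231_SucE:
  assumes "zs \<in> Av231 (Suc m)"
  obtains k xs ys where "k \<le> m" "xs \<in> Av231 k" "ys \<in> Av231 (m - k)"
    "zs = xs @ Suc m # map (\<lambda>x. x + k) ys"
proof -
  have zs: "set zs = {1..Suc m}" "distinct zs" "avoids_231 zs"
    using assms by (auto simp: Av231_iff)
  then have "Suc m \<in> set zs" by simp
  then obtain xs ws where z: "zs = xs @ Suc m # ws" by (meson split_list)
  have "distinct (xs @ Suc m # ws)" using zs(2) unfolding z .
  then have dist: "distinct xs" "distinct ws" and disj: "set xs \<inter> set ws = {}"
    and "Suc m \<notin> set xs \<union> set ws" by simp_all
  then have "set xs \<union> set ws = set zs - {Suc m}" unfolding z by auto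
  also have "\<dots> = {1..m}" unfolding zs(1) by auto
  finally have m: "set xs \<union> set ws = {1..m}" .
  have lt: "\<forall>x\<in>set xs \<union> set ws. x < Suc m" unfolding m by auto
  have av: "avoids_231 xs" "avoids_231 ws" "\<forall>x\<in>set xs. \<forall>y\<in>set ws. x \<le> y"
    using zs(3) unfolding z avoids_231_append_max [OF lt] by auto
  \<comment> \<open>Inserting 0 covers an empty left block, which has to give
    \<open>k = 0\<close>.\<close>
  define k where "k = Max (insert 0 (set xs))"
  have k: "k = 0 \<or> k \<in> set xs" "\<forall>x\<in>set xs. x \<le> k"
    using Max_in [of "insert 0 (set xs)"] by (auto simp: k_def)
  have "k \<le> m" using k(1) m by auto
  \<comment> \<open>Avoidance gives only a weak inequality; disjointness of the blocks makes it
    strict. For \<open>k = 0\<close> it suffices that entries are positive.\<close>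
  have gt: "k < y" if "y \<in> set ws" for y
  proof -
    have "y \<in> {1..m}" using that unfolding m [symmetric] by blast
    moreover have "k = 0 \<or> k \<le> y \<and> k \<noteq> y" using that k(1) av(3) disj by blast
    ultimately show ?thesis by auto
  qed
  have sx: "set xs = {1..k}"
  proof (intro equalityI subsetI)
    fix x assume "x \<in> {1..k}"
    then have "x \<in> {1..m}" "\<not> k < x" using \<open>k \<le> m\<close> by auto
    with gt show "x \<in> set xs" unfolding m [symmetric] by blast
  next
    fix x assume x: "x \<in> set xs"
    then have "x \<in> {1..m}" unfolding m [symmetric] by blast
    with x k(2) show "x \<in> {1..k}" by simp
  qed
  have "set ws = {1..m} - {1..k}"
    using disj unfolding m [symmetric] sx [symmetric] by blast
  also have "\<dots> = {k + 1..m}" by auto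
  finally have sw: "set ws = {k + 1..m}" .
  \<comment> \<open>Truncated subtraction loses nothing, as all entries of \<open>ws\<close> exceed
    \<open>k\<close>.\<close>
  define ys where "ys = map (\<lambda>x. x - k) ws"
  have w: "ws = map (\<lambda>x. x + k) ys"
    unfolding ys_def using sw by (auto intro!: map_idI [symmetric])
  show thesis
  proof
    show "k \<le> m" by fact
    show "xs \<in> Av231 k" using sx av(1) dist(1) by (simp only: Av231_iff)
    have "(\<lambda>x. x + k) ` set ys = set ws" using w by (metis list.set_map)
    also have "\<dots> = (\<lambda>x. x + k) ` {1..m - k}"
      unfolding sw using \<open>k \<le> m\<close> by (simp add: image_add_atLeastAtMost' add.commute)
    finally have "(\<lambda>x. x + k) ` set ys = (\<lambda>x. x + k) ` {1..m - k}" .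
    moreover have "inj (\<lambda>x. x + k)" by (simp add: inj_def)
    ultimately have "set ys = {1..m - k}" by (metis inj_image_eq_iff)
    then show "ys \<in> Av231 (m - k)"
      using av(2) dist(2) unfolding w by (simp only: Av231_iff distinct_map avoids_231_map_add)
    show "zs = xs @ Suc m # map (\<lambda>x. x + k) ys" unfolding z w [symmetric] ..
  qed
qed

lemma bij_betw_Av231_Suc:
  "bij_betw (\<lambda>(k, xs, ys). xs @ Suc m # map (\<lambda>x. x + k) ys)
     (SIGMA k:{..m}. Av231 k \<times> Av231 (m - k)) (Av231 (Suc m))"
proof (rule bij_betwI')
  fix p q assume pq: "p \<in> (SIGMA k:{..m}. Av231 k \<times> Av231 (m - k))"
    "q \<in> (SIGMA k:{..m}. Av231 k \<times> Av231 (m - k))"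
  obtain k xs ys where p: "p = (k, xs, ys)" by (metis prod_cases3)
  obtain l xs' ys' where q: "q = (l, xs', ys')" by (metis prod_cases3)
  have max: "Suc m \<notin> set xs" "Suc m \<notin> set xs'"
    using pq p q by (auto simp: Av231_iff)
  have "Suc m \<notin> set (map (\<lambda>x. x + k) ys)" "Suc m \<notin> set (map (\<lambda>x. x + l) ys')"
    using pq p q by (auto simp: Av231_iff)
  with max have "xs @ Suc m # map (\<lambda>x. x + k) ys = xs' @ Suc m # map (\<lambda>x. x + l) ys' \<longleftrightarrow>
      xs = xs' \<and> map (\<lambda>x. x + k) ys = map (\<lambda>x. x + l) ys'"
    by (intro append_Cons_eq_iff) auto
  also have "\<dots> \<longleftrightarrow> k = l \<and> xs = xs' \<and> ys = ys'"
  proof -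
    \<comment> \<open>The left block determines the shift, so the right block can be shifted back
      uniquely.\<close>
    have "k = length xs" "l = length xs'" using pq p q length_Av231 by auto
    moreover have "inj (map (\<lambda>x. x + k))" by (simp add: inj_def)
    ultimately show ?thesis by (auto dest: injD)
  qed
  finally show "(case p of (k, xs, ys) \<Rightarrow> xs @ Suc m # map (\<lambda>x. x + k) ys) =
      (case q of (k, xs, ys) \<Rightarrow> xs @ Suc m # map (\<lambda>x. x + k) ys) \<longleftrightarrow> p = q"
    by (simp add: p q)
next
  fix p assume "p \<in> (SIGMA k:{..m}. Av231 k \<times> Av231 (m - k))"
  then show "(case p of (k, xs, ys) \<Rightarrow> xs @ Suc m # map (\<lambda>x. x + k) ys) \<in> Av231 (Suc m)"
    by (auto intro: Av231_append_map)
next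
  fix zs assume "zs \<in> Av231 (Suc m)"
  then obtain k xs ys where "k \<le> m" "xs \<in> Av231 k" "ys \<in> Av231 (m - k)"
    "zs = xs @ Suc m # map (\<lambda>x. x + k) ys" by (rule Av231_SucE)
  then show "\<exists>p\<in>SIGMA k:{..m}. Av231 k \<times> Av231 (m - k).
      zs = (case p of (k, xs, ys) \<Rightarrow> xs @ Suc m # map (\<lambda>x. x + k) ys)"
    by (intro bexI [of _ "(k, xs, ys)"]) auto
qed

section \<open>Recurrence and rescaling\<close>

lemma P_pk_des_1: "P_pk_des (Av231 1) y t = y * t"
proof -
  have "Av231 1 = {[1]}"
    by (auto simp: Av231_def permutations_of_set_singleton)
  then show ?thesis by (simp add: P_pk_des_def)
qed

text \<open>An empty left block costs a factor \<open>t\<close> for the descent after the maximum;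
  an empty right block costs nothing. If both are nonempty, the new peak and the new descent supply
  the second +1 in each exponent, so weights simply multiply.\<close>

lemma P_pk_des_Suc:
  assumes "m > 0"
  shows "P_pk_des (Av231 (Suc m)) y t = (1 + t) * P_pk_des (Av231 m) y t +
    (\<Sum>k\<in>{1..<m}. P_pk_des (Av231 k) y t * P_pk_des (Av231 (m - k)) y t)"
proof -
  let ?w = "\<lambda>xs. y ^ (pk xs + 1) * t ^ (des xs + 1)"
  define F where "F k = (\<Sum>xs\<in>Av231 k. \<Sum>ys\<in>Av231 (m - k).
    ?w (xs @ Suc m # map (\<lambda>x. x + k) ys))" for k
  have "P_pk_des (Av231 (Suc m)) y t = (\<Sum>k\<in>{..m}. F k)"
    unfolding P_pk_des_def F_def
    by (subst sum.reindex_bij_betw [OF bij_betw_Av231_Suc, symmetric])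
       (simp add: sum.Sigma sum.cartesian_product case_prod_unfold)
  also have "{..m} = insert 0 (insert m {1..<m})" using assms by auto
  also have "(\<Sum>k\<in>\<dots>. F k) = F 0 + F m + (\<Sum>k\<in>{1..<m}. F k)"
    using assms by simp
  finally have split: "P_pk_des (Av231 (Suc m)) y t = F 0 + F m + (\<Sum>k\<in>{1..<m}. F k)" .
  have w: "?w (xs @ Suc m # map (\<lambda>x. x + k) ys) =
      y ^ (pk xs + pk ys + of_bool (xs \<noteq> [] \<and> ys \<noteq> []) + 1) *
      t ^ (des xs + des ys + of_bool (ys \<noteq> []) + 1)"
    if "k \<le> m" "xs \<in> Av231 k" "ys \<in> Av231 (m - k)" for k xs ys
  proof -
    have "\<forall>x\<in>set xs \<union> set (map (\<lambda>x. x + k) ys). x < Suc m"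
      using that by (auto simp: Av231_iff)
    then show ?thesis by (simp add: des_append_max pk_append_max)
  qed
  have ne: "xs \<noteq> []" if "xs \<in> Av231 k" "k > 0" for xs k
    using that length_Av231 by fastforce
  have "F 0 = t * P_pk_des (Av231 m) y t"
    unfolding F_def P_pk_des_def sum_distrib_left Av231_0
    using w [of 0 "[]"] ne assms by (simp add: Av231_0 mult_ac)
  moreover have "F m = P_pk_des (Av231 m) y t"
    unfolding F_def P_pk_des_def
    using w [of m _ "[]"] by (simp add: Av231_0)
  moreover have "F k = P_pk_des (Av231 k) y t * P_pk_des (Av231 (m - k)) y t"
    if "k \<in> {1..<m}" for k
    unfolding F_def P_pk_des_def sum_product
  proof (intro sum.cong refl)
    fix xs ys assume "xs \<in> Av231 k" "ys \<in> Av231 (m - k)"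
    moreover from this have "xs \<noteq> []" "ys \<noteq> []" using ne that by auto
    ultimately show "?w (xs @ Suc m # map (\<lambda>x. x + k) ys) = ?w xs * ?w ys"
      using w [of k xs ys] that by (simp add: power_add mult_ac)
  qed
  ultimately show ?thesis unfolding split by (simp add: algebra_simps)
qed

text \<open>Both sides satisfy the same recurrence with the same initial value. The exponent
  \<open>n + 1\<close> fits the convolution, because \<open>(k + 1) + (m - k + 1) = m + 2\<close>;
  in the linear term one factor \<open>d\<close> is left over to turn \<open>1 + v\<close> into
  \<open>1 + t\<close>. A general commutative ring covers both rational functions and power
  series.\<close>

lemma P_pk_des_rescale:
  fixes d t v x y :: "'a::comm_ring_1"
  assumes "d * (1 + v) = 1 + t" "d ^ 2 * (x * v) = y * t" "n \<ge> 1"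
  shows "P_pk_des (Av231 n) y t = d ^ (n + 1) * P_pk_des (Av231 n) x v"
  using assms(3)
proof (induction n rule: less_induct)
  case (less n)
  show ?case
  proof (cases "n = 1")
    case True
    show ?thesis unfolding True P_pk_des_1 using assms(2) by (simp add: power2_eq_square)
  next
    case False
    with less.prems obtain m where m: "n = Suc m" "m > 0" by (cases n) auto
    have "P_pk_des (Av231 k) y t * P_pk_des (Av231 (m - k)) y t =
        d ^ (n + 1) * (P_pk_des (Av231 k) x v * P_pk_des (Av231 (m - k)) x v)"
      if "k \<in> {1..<m}" for k
    proof -
      have "(k + 1) + (m - k + 1) = n + 1" using that m by simp
      then have "d ^ (n + 1) = d ^ (k + 1) * d ^ (m - k + 1)" by (metis power_add)
      moreover have "P_pk_des (Av231 k) y t = d ^ (k + 1) * P_pk_des (Av231 k) x v"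
        "P_pk_des (Av231 (m - k)) y t = d ^ (m - k + 1) * P_pk_des (Av231 (m - k)) x v"
        by (rule less.IH; use that m in auto)+
      ultimately show ?thesis by (simp only: mult_ac)
    qed
    moreover have "(1 + t) * P_pk_des (Av231 m) y t =
        d ^ (n + 1) * ((1 + v) * P_pk_des (Av231 m) x v)"
      using less.IH [of m] m by (simp add: assms(1) [symmetric] mult_ac)
    ultimately show ?thesis
      unfolding m(1) P_pk_des_Suc [OF m(2)]
      by (simp only: m(1) [symmetric] distrib_left sum_distrib_left cong: sum.cong)
  qed
qed

lemma narayana_eq_P_pk_des: "narayana n t = P_pk_des (Av231 n) 1 t"
  by (simp add: narayana_def P_pk_des_def)

section \<open>The two substitutions\<close>

lemma ratfun_denominators_nonzero:
  "1 + y_rf \<noteq> 0" "y_rf + t_rf \<noteq> 0" "1 + y_rf * t_rf \<noteq> 0"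
proof -
  have "1 + y_rf = to_fract (1 + [:[:0, 1:]:])" "y_rf + t_rf = to_fract ([:[:0, 1:]:] + [:0, 1:])"
    "1 + y_rf * t_rf = to_fract (1 + [:[:0, 1:]:] * [:0, 1:])"
    by (simp_all only: y_rf_def t_rf_def to_fract_add to_fract_mult to_fract_1)
  then show "1 + y_rf \<noteq> 0" "y_rf + t_rf \<noteq> 0" "1 + y_rf * t_rf \<noteq> 0"
    by (simp_all only: to_fract_eq_0_iff) (simp_all add: one_pCons)
qed

text \<open>With \<open>d = (1 + t) / (1 + v)\<close> this says \<open>d^2 * v = y * t\<close>, the
  second condition for rescaling from \<open>x = 1\<close>.\<close>

lemma v_ps_quadratic: "(1 + t_ps) ^ 2 * v_ps = y_ps * t_ps * (1 + v_ps) ^ 2"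
proof -
  let ?c = "2 * y_ps * t_ps"
  have "?c \<noteq> 0" unfolding y_ps_factor by (rule linear_t_nonzero)
  \<comment> \<open>With the factor \<open>2 * ?c\<close> the right side is the square of
    \<open>?c + ?c * v_ps\<close>, so \<open>v_ps\<close> occurs only through
    \<open>?c * v_ps\<close>, which is linear in the square root.\<close>
  moreover have "2 * ?c * ((1 + t_ps) ^ 2 * v_ps) = 2 * ?c * (y_ps * t_ps * (1 + v_ps) ^ 2)"
    using v_ps_eq sqrt_ps_square by algebra
  ultimately show ?thesis by (subst (asm) mult_cancel_left) simp
qed

text \<open>This identifies \<open>(1 + u) / (1 + u v)\<close> with the scaling factor
  \<open>(1 + t) / (1 + v)\<close>. Once denominators are cleared, \<open>u_ps\<close> and
  \<open>v_ps\<close> are linear in the square root, whose square is known.\<close>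

lemma u_ps_v_ps_relation: "(1 + u_ps) * (1 + v_ps) = (1 + t_ps) * (1 + u_ps * v_ps)"
proof -
  let ?b = "2 * (1 - y_ps) * t_ps" and ?c = "2 * y_ps * t_ps"
  have "?c \<noteq> 0" "?b \<noteq> 0" unfolding y_ps_factor neg_equal_0_iff_equal by (rule linear_t_nonzero)+
  then have "?b * ?c \<noteq> 0" by simp
  moreover have "?b * ?c * ((1 + u_ps) * (1 + v_ps)) = ?b * ?c * ((1 + t_ps) * (1 + u_ps * v_ps))"
    using v_ps_eq u_ps_eq sqrt_ps_square by algebra
  ultimately show ?thesis by (subst (asm) mult_cancel_left) simp
qed

theorem corollary5p3:
  fixes n :: nat
  assumes "n \<ge> 1"
  shows
    "narayana n t_rf =
       ((1 + y_rf * t_rf) / (1 + y_rf)) ^ (n + 1) *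
       P_pk_des (Av231 n)
         ((1 + y_rf) ^ 2 * t_rf / ((y_rf + t_rf) * (1 + y_rf * t_rf)))
         ((y_rf + t_rf) / (1 + y_rf * t_rf))
     \<and>
     P_pk_des (Av231 n) y_ps t_ps =
       (exact_quot (1 + u_ps) (1 + u_ps * v_ps)) ^ (n + 1) * narayana n v_ps"
proof
  note nz = ratfun_denominators_nonzero
  show "narayana n t_rf =
       ((1 + y_rf * t_rf) / (1 + y_rf)) ^ (n + 1) *
       P_pk_des (Av231 n)
         ((1 + y_rf) ^ 2 * t_rf / ((y_rf + t_rf) * (1 + y_rf * t_rf)))
         ((y_rf + t_rf) / (1 + y_rf * t_rf))"
    unfolding narayana_eq_P_pk_des
  \<comment> \<open>Here the Narayana polynomial is the left side of the rescaling, with first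
    argument 1; in the second identity it is on the right.\<close>
  proof (rule P_pk_des_rescale [OF _ _ assms])
    have "(1 + y_rf * t_rf) / (1 + y_rf) * (1 + (y_rf + t_rf) / (1 + y_rf * t_rf)) =
        (1 + y_rf * t_rf + (y_rf + t_rf)) / (1 + y_rf)"
      using nz by (simp add: add_divide_eq_iff add.assoc)
    also have "1 + y_rf * t_rf + (y_rf + t_rf) = (1 + t_rf) * (1 + y_rf)"
      by (simp add: algebra_simps)
    finally show "(1 + y_rf * t_rf) / (1 + y_rf) * (1 + (y_rf + t_rf) / (1 + y_rf * t_rf)) =
        1 + t_rf" using nz(1) by simp
    show "((1 + y_rf * t_rf) / (1 + y_rf))\<^sup>2 *
        ((1 + y_rf)\<^sup>2 * t_rf / ((y_rf + t_rf) * (1 + y_rf * t_rf)) *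
          ((y_rf + t_rf) / (1 + y_rf * t_rf))) = 1 * t_rf"
      using nz by (simp add: power_divide power2_eq_square)
  qed
  let ?d = "exact_quot (1 + u_ps) (1 + u_ps * v_ps)"
  have uv: "1 + u_ps * v_ps \<noteq> 0"
    by (rule notI, drule arg_cong [of _ _ "\<lambda>f. fps_nth f 0"]) (simp add: u_ps_nth_0)
  have t: "1 + t_ps \<noteq> 0"
    by (rule notI, drule arg_cong [of _ _ "\<lambda>f. fps_nth f 0"]) (simp add: t_ps_def)
  have "(1 + u_ps * v_ps) * (?d * (1 + v_ps)) = (1 + u_ps * v_ps) * (1 + t_ps)"
    using exact_quot_one_plus_uv u_ps_v_ps_relation by algebra
  with uv have d: "?d * (1 + v_ps) = 1 + t_ps" by simp
  \<comment> \<open>Squaring \<open>d\<close> turns the left side into \<open>(1 + t)^2 * v\<close>,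
    which the quadratic evaluates.\<close>
  have "(1 + v_ps) ^ 2 * (?d ^ 2 * (1 * v_ps)) = (1 + v_ps) ^ 2 * (y_ps * t_ps)"
    using d v_ps_quadratic by algebra
  \<comment> \<open>If \<open>1 + v_ps\<close> vanished, so would its multiple
    \<open>1 + t_ps\<close>.\<close>
  moreover have "(1 + v_ps) ^ 2 \<noteq> 0" using d t by auto
  ultimately have "?d ^ 2 * (1 * v_ps) = y_ps * t_ps" by (subst (asm) mult_cancel_left) simp
  with d show "P_pk_des (Av231 n) y_ps t_ps = ?d ^ (n + 1) * narayana n v_ps"
    unfolding narayana_eq_P_pk_des by (rule P_pk_des_rescale [OF _ _ assms])
qed

end
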